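(* Let $G$ be a finite simple undirected graph with bandwidth $b$. Then $\mathrm{cub}(G)\le b+1$, where $\mathrm{cub}(G)$ denotes the cubicity of $G$.
   Context: All graphs are simple, finite and undirected. Cubicity: a $k$-cube is a Cartesian product $R_1\times\cdots\times R_k$ where each $R_i$ is a closed interval of the form $[a_i,a_i+1]$ on the real line. The cubicity $\mathrm{cub}(G)$ is the minimum $k$ such that each vertex of $G$ can be mapped to a $k$-cube so that two distinct vertices are adjacent in $G$ if and only if their $k$-cubes have non-empty intersection. Bandwidth: for a graph $G=(V,E)$ on $n$ vertices, a linear ordering of $G$ is a bijection $f:V\to\{1,\ldots,n\}$; its width is $\max_{(u,v)\in E}|f(u)-f(v)|$ (taken to be $0$ if $E=\emptyset$). The bandwidth of $G$ is the minimum width over all linear orderings of $G$. *)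

theory Defs
  imports Complex_Main "HOL-Library.FuncSet" "Graph_Theory.Digraph"
begin

text \<open>
  A finite simple undirected graph is a symmetric digraph without loops and parallel arcs, i.e.
  a \<^term>\<open>G\<close> with \<^prop>\<open>graph G\<close>; vertices \<open>u\<close> and \<open>v\<close> are adjacent iff \<^prop>\<open>u \<rightarrow>\<^bsub>G\<^esub> v\<close>.
\<close>

subsection \<open>Cubicity\<close>

text \<open>
  Points of \<open>k\<close>-dimensional real space are the extensional functions on \<^term>\<open>{1..k}\<close>.
  The case \<open>k = 0\<close> is allowed: the empty product is a single point, so complete graphs
  have cubicity \<open>0\<close>.
\<close>

definition is_cube :: "nat \<Rightarrow> (nat \<Rightarrow> real) set \<Rightarrow> bool" where
  "is_cube k R \<longleftrightarrow> (\<exists>a :: nat \<Rightarrow> real. R = (\<Pi>\<^sub>E i\<in>{1..k}. {a i..a i + 1}))"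

definition cube_representation ::
    "('a, 'b) pre_digraph \<Rightarrow> nat \<Rightarrow> ('a \<Rightarrow> (nat \<Rightarrow> real) set) \<Rightarrow> bool" where
  "cube_representation G k \<phi> \<longleftrightarrow>
     (\<forall>v\<in>verts G. is_cube k (\<phi> v)) \<and>
     (\<forall>u\<in>verts G. \<forall>v\<in>verts G. u \<noteq> v \<longrightarrow> (u \<rightarrow>\<^bsub>G\<^esub> v \<longleftrightarrow> \<phi> u \<inter> \<phi> v \<noteq> {}))"

definition cubicity :: "('a, 'b) pre_digraph \<Rightarrow> nat" where
  "cubicity G = (LEAST k. \<exists>\<phi>. cube_representation G k \<phi>)"

subsection \<open>Bandwidth\<close>

definition linear_ordering :: "('a, 'b) pre_digraph \<Rightarrow> ('a \<Rightarrow> nat) \<Rightarrow> bool" where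
  "linear_ordering G f \<longleftrightarrow> bij_betw f (verts G) {1..card (verts G)}"

definition ordering_width :: "('a, 'b) pre_digraph \<Rightarrow> ('a \<Rightarrow> nat) \<Rightarrow> nat" where
  "ordering_width G f =
     (if arcs_ends G = {} then 0
      else Max ((\<lambda>(u, v). nat \<bar>int (f u) - int (f v)\<bar>) ` arcs_ends G))"

definition bandwidth :: "('a, 'b) pre_digraph \<Rightarrow> nat" where
  "bandwidth G = (LEAST w. \<exists>f. linear_ordering G f \<and> ordering_width G f = w)"

subsection \<open>Both minima range over nonempty sets\<close>

lemma linear_ordering_exists:
  assumes "graph G"
  shows "\<exists>f. linear_ordering G f"
proof -
  interpret graph G by fact
  show ?thesis
    unfolding linear_ordering_def using ex_bij_betw_finite_nat[OF finite_verts]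
    by (metis card_atLeastAtMost diff_Suc_1 finite_atLeastAtMost finite_same_card_bij finite_verts)
qed

lemma bandwidth_attained:
  assumes "graph G"
  shows "\<exists>f. linear_ordering G f \<and> ordering_width G f = bandwidth G"
  unfolding bandwidth_def
  by (rule LeastI_ex) (use linear_ordering_exists[OF assms] in blast)

lemma cubes_meet_iff:
  fixes a b :: "nat \<Rightarrow> real"
  shows "(\<Pi>\<^sub>E i\<in>{1..k}. {a i..a i + 1}) \<inter> (\<Pi>\<^sub>E i\<in>{1..k}. {b i..b i + 1}) \<noteq> {} \<longleftrightarrow>
    (\<forall>i\<in>{1..k}. \<bar>a i - b i\<bar> \<le> 1)"
proof -
  have "{x..x + 1} \<inter> {y..y + 1} \<noteq> {} \<longleftrightarrow> \<bar>x - y\<bar> \<le> 1" for x y :: real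
    by (auto simp: abs_if)
  then show ?thesis
    by (simp add: PiE_Int PiE_eq_empty_iff)
qed

lemma cube_representation_exists:
  assumes "graph G"
  shows "\<exists>k \<phi>. cube_representation G k \<phi>"
proof -
  interpret graph G by fact
  obtain f where f: "bij_betw f (verts G) {1..card (verts G)}"
    using linear_ordering_exists[OF assms] unfolding linear_ordering_def by blast
  define w where "w = the_inv_into (verts G) f"
  have w: "w (f v) = v" if "v \<in> verts G" for v
    unfolding w_def using f that by (simp add: bij_betw_def the_inv_into_f_f)
  have fin: "f v \<in> {1..card (verts G)}" if "v \<in> verts G" for v
    using f that by (auto simp: bij_betw_def)
  define a where "a = (\<lambda>v i. if v = w i then 0 else if w i \<rightarrow>\<^bsub>G\<^esub> v then 1 else 2 :: real)"
  define \<phi> where "\<phi> = (\<lambda>v. \<Pi>\<^sub>E i\<in>{1..card (verts G)}. {a v i..a v i + 1})"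
  have sym: "v \<rightarrow>\<^bsub>G\<^esub> u \<longleftrightarrow> u \<rightarrow>\<^bsub>G\<^esub> v" for u v
    using arcs_ends_symmetric[OF sym_arcs] by blast
  have "u \<rightarrow>\<^bsub>G\<^esub> v \<longleftrightarrow> (\<forall>i\<in>{1..card (verts G)}. \<bar>a u i - a v i\<bar> \<le> 1)"
    if uv: "u \<in> verts G" "v \<in> verts G" "u \<noteq> v" for u v
  proof
    assume "u \<rightarrow>\<^bsub>G\<^esub> v"
    then show "\<forall>i\<in>{1..card (verts G)}. \<bar>a u i - a v i\<bar> \<le> 1"
      using sym by (auto simp: a_def)
  next
    assume "\<forall>i\<in>{1..card (verts G)}. \<bar>a u i - a v i\<bar> \<le> 1"
    then have "\<bar>a u (f u) - a v (f u)\<bar> \<le> 1"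
      using fin[OF uv(1)] by blast
    then show "u \<rightarrow>\<^bsub>G\<^esub> v"
      using uv by (auto simp: a_def w split: if_splits)
  qed
  then have "cube_representation G (card (verts G)) \<phi>"
    unfolding cube_representation_def is_cube_def \<phi>_def cubes_meet_iff by blast
  then show ?thesis
    by blast
qed

lemma cubicity_attained:
  assumes "graph G"
  shows "\<exists>\<phi>. cube_representation G (cubicity G) \<phi>"
  unfolding cubicity_def
  by (rule LeastI_ex) (use cube_representation_exists[OF assms] in blast)

end

theory Submission
  imports Defs
begin

text \<open>
  Order the vertices along an optimal linear ordering. One coordinate, proportional to the position,
  separates all pairs at distance more than \<open>b\<close>. Each residue class modulo \<open>b\<close> gets one further
  coordinate, which separates every vertex of that class (an anchor) from its non-neighbours among
  the next \<open>b\<close> positions. From an anchor at \<open>x\<close>, its neighbours up to the next anchor are put at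
  \<open>x + 2s\<close> and its non-neighbours at \<open>x + 3s\<close>, with a sign \<open>s\<close> and adjacency threshold \<open>2\<close>.
  If the next anchor is a neighbour, it moves on to \<open>x + s\<close> with the same sign; otherwise it
  jumps over the block to \<open>x + 4s\<close> and the direction \<open>s\<close> is reversed.
\<close>

primrec anchor :: "(nat \<Rightarrow> nat \<Rightarrow> bool) \<Rightarrow> nat \<Rightarrow> nat \<Rightarrow> int \<times> int" where
  "anchor A b 0 = (0, 1)"
| "anchor A b (Suc q) = (let (x, s) = anchor A b q in
     if A (q * b) (Suc q * b) then (x + s, s) else (x + 4 * s, - s))"

definition coord :: "(nat \<Rightarrow> nat \<Rightarrow> bool) \<Rightarrow> nat \<Rightarrow> nat \<Rightarrow> int" where
  "coord A b m = (let q = m div b; (x, s) = anchor A b q in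
     if b dvd m then x else if A (q * b) m then x + 2 * s else x + 3 * s)"

lemma anchor_sign: "snd (anchor A b q) = 1 \<or> snd (anchor A b q) = - 1"
  by (induction q) (auto simp: Let_def case_prod_beta)

text \<open>Positions \<open>i + 1\<close> to \<open>i + b\<close> contain only one multiple of
  \<open>b\<close>, so \<open>j\<close> is at most one block further; starting from a multiple, only
  \<open>j = i + b\<close> gets there.\<close>

lemma block_cases:
  fixes i j b :: nat
  assumes "0 < b" "i < j" "j \<le> i + b"
  obtains (same) "j div b = i div b" "\<not> b dvd j"
  | (anchors) "b dvd i" "b dvd j" "j div b = Suc (i div b)"
  | (step) "\<not> b dvd i" "j div b = Suc (i div b)"
proof -
  have "i div b \<le> j div b" "j div b \<le> Suc (i div b)"
    using assms div_le_mono[of i j b] div_le_mono[of j "i + b" b] by auto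
  then consider "j div b = i div b" | "j div b = Suc (i div b)"
    by linarith
  then show ?thesis
  proof cases
    case 1
    have "\<not> b dvd j"
    proof
      assume "b dvd j"
      then have "j = i div b * b" using 1 by (metis dvd_div_mult_self)
      then show False using assms(2) div_times_less_eq_dividend[of i b] by linarith
    qed
    with 1 show ?thesis by (rule same)
  next
    case 2
    show ?thesis
    proof (cases "b dvd i")
      case True
      then have i: "i div b * b = i" by simp
      have "Suc (i div b) * b \<le> j" using 2 by (metis div_times_less_eq_dividend)
      then have "j = b + i" using i assms(3) by simp
      then have "b dvd j" using True by simp
      with True show ?thesis using 2 by (rule anchors)
    next
      case False
      then show ?thesis using 2 by (rule step)
    qed
  qed
qed

lemma coord_adjacent:
  assumes "0 < b" "i < j" "j \<le> i + b" "A i j"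
  shows "\<bar>coord A b i - coord A b j\<bar> \<le> 2"
proof -
  obtain x s where xs: "anchor A b (i div b) = (x, s)" by fastforce
  have s: "s = 1 \<or> s = - 1" using anchor_sign[of A b "i div b"] xs by simp
  from assms(1-3) show ?thesis
  proof (cases rule: block_cases)
    case same
    then show ?thesis using s xs assms(4) by (auto simp: coord_def)
  next
    case anchors
    then have "i div b * b = i" "Suc (i div b) * b = j" by (metis dvd_div_mult_self)+
    then show ?thesis using anchors s xs assms(4) by (auto simp: coord_def)
  next
    \<comment> \<open>\<open>i\<close> sits at \<open>x + 2 * s\<close> or \<open>x + 3 * s\<close>;
      the next block uses offsets 1, 3, 4 (times \<open>s\<close>), or 4, 2, 1 after a reversal. All
      gaps are at most 2.\<close>
    case step
    then show ?thesis using s xs by (auto simp: coord_def Let_def)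
  qed
qed

text \<open>As \<open>i\<close> is an anchor, the gap is 3 inside its block and 4 at the next
  anchor.\<close>

lemma coord_nonadjacent:
  assumes "0 < b" "i < j" "j \<le> i + b" "b dvd i" "\<not> A i j"
  shows "\<bar>coord A b i - coord A b j\<bar> > 2"
proof -
  obtain x s where xs: "anchor A b (i div b) = (x, s)" by fastforce
  have s: "s = 1 \<or> s = - 1" using anchor_sign[of A b "i div b"] xs by simp
  from assms(1-3) show ?thesis
  proof (cases rule: block_cases)
    case same
    then show ?thesis using s xs assms(4,5) by (auto simp: coord_def)
  next
    case anchors
    then have "i div b * b = i" "Suc (i div b) * b = j" by (metis dvd_div_mult_self)+
    then show ?thesis using anchors s xs assms(5) by (auto simp: coord_def)
  next
    case step
    then show ?thesis using assms(4) by simp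
  qed
qed

text \<open>Every position becomes an anchor in one of the shifted coordinates; a multiple of
  \<open>b\<close> takes shift \<open>b\<close>, since coordinates start at 1.\<close>

lemma ex_shift_dvd:
  fixes i b :: nat
  assumes "0 < b"
  shows "\<exists>r\<in>{1..b}. b dvd i + r"
proof
  have "i mod b < b" using assms by simp
  then have "i + (b - i mod b) = i div b * b + b"
    using div_mult_mod_eq[of i b] by linarith
  then show "b dvd i + (b - i mod b)" by simp
  show "b - i mod b \<in> {1..b}" using \<open>i mod b < b\<close> by auto
qed

lemma arc_width_le:
  assumes "graph G" "u \<rightarrow>\<^bsub>G\<^esub> v"
  shows "nat \<bar>int (f u) - int (f v)\<bar> \<le> ordering_width G f"
proof -
  interpret graph G by fact
  have "finite (arcs_ends G)" unfolding arcs_ends_def by simp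
  then show ?thesis
    using assms(2) unfolding ordering_width_def by (force intro!: Max_ge)
qed

text \<open>
  Coordinate \<open>b + 1\<close> is the one proportional to the position; dividing by \<open>b + 1/2\<close> rather than
  \<open>b\<close> covers \<open>b = 0\<close>. Positions are shifted by \<open>i\<close> in coordinate \<open>i\<close> so that the anchors
  become the multiples of \<open>b\<close>.
\<close>

definition cube_corner :: "(nat \<Rightarrow> nat \<Rightarrow> bool) \<Rightarrow> nat \<Rightarrow> nat \<Rightarrow> nat \<Rightarrow> real" where
  "cube_corner E b m i =
     (if i = b + 1 then real m / (real b + 1 / 2)
      else real_of_int (coord (\<lambda>p q. E (p - i) (q - i)) b (m + i)) / 2)"

lemma cube_corner_iff:
  assumes less: "m < n" and band: "E m n \<Longrightarrow> n \<le> m + b"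
  shows "E m n \<longleftrightarrow> (\<forall>i\<in>{1..b + 1}. \<bar>cube_corner E b m i - cube_corner E b n i\<bar> \<le> 1)"
proof
  assume E: "E m n"
  show "\<forall>i\<in>{1..b + 1}. \<bar>cube_corner E b m i - cube_corner E b n i\<bar> \<le> 1"
  proof
    fix i assume i: "i \<in> {1..b + 1}"
    show "\<bar>cube_corner E b m i - cube_corner E b n i\<bar> \<le> 1"
    proof (cases "i = b + 1")
      case True
      have "real n \<le> real m + real b" using band[OF E] by linarith
      then show ?thesis using True less
        by (simp add: cube_corner_def diff_divide_distrib[symmetric] abs_if field_simps)
    next
      case False
      let ?c = "coord (\<lambda>p q. E (p - i) (q - i)) b"
      \<comment> \<open>Truncated subtraction is harmless: \<open>m + i - i = m\<close>, and
        \<open>coord_adjacent\<close> allows any relation. Halving then turns threshold 2 into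
        1.\<close>
      have "\<bar>?c (m + i) - ?c (n + i)\<bar> \<le> 2"
        by (rule coord_adjacent) (use False i less band[OF E] E in auto)
      then have "\<bar>real_of_int (?c (m + i)) - real_of_int (?c (n + i))\<bar> \<le> 2"
        by linarith
      then show ?thesis using False by (simp add: cube_corner_def)
    qed
  qed
next
  assume close: "\<forall>i\<in>{1..b + 1}. \<bar>cube_corner E b m i - cube_corner E b n i\<bar> \<le> 1"
  then have "\<bar>cube_corner E b m (b + 1) - cube_corner E b n (b + 1)\<bar> \<le> 1" by simp
  then have "\<bar>real m - real n\<bar> \<le> real b + 1 / 2"
    by (simp add: cube_corner_def diff_divide_distrib[symmetric] abs_divide)
  \<comment> \<open>Positions are integers, so the slack 1/2 disappears.\<close>
  then have near: "n \<le> m + b" using less by linarith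
  then have "0 < b" using less by simp
  \<comment> \<open>Coordinate \<open>r\<close> makes the earlier position \<open>m\<close> an
    anchor.\<close>
  then obtain r where r: "r \<in> {1..b}" "b dvd m + r" using ex_shift_dvd by blast
  let ?c = "coord (\<lambda>p q. E (p - r) (q - r)) b"
  show "E m n"
  proof (rule ccontr)
    assume "\<not> E m n"
    then have "\<bar>?c (m + r) - ?c (n + r)\<bar> > 2"
      by (intro coord_nonadjacent) (use \<open>0 < b\<close> near less r in auto)
    then have "\<bar>real_of_int (?c (m + r)) - real_of_int (?c (n + r))\<bar> > 2"
      by linarith
    moreover have "\<bar>cube_corner E b m r - cube_corner E b n r\<bar> \<le> 1"
      using close r by simp
    ultimately show False using r by (simp add: cube_corner_def)
  qed
qed

theorem theorem2:
  fixes G :: "('a, 'b) pre_digraph" and b :: nat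
  assumes "graph G"
    and "bandwidth G = b"
  shows "cubicity G \<le> b + 1"
proof -
  interpret graph G by fact
  obtain f where f: "bij_betw f (verts G) {1..card (verts G)}" "ordering_width G f = b"
    using bandwidth_attained[OF assms(1)] assms(2) unfolding linear_ordering_def by blast
  \<comment> \<open>Adjacency is transported to positions; injectivity of \<open>f\<close> makes the
    transport faithful.\<close>
  define E where "E m n \<longleftrightarrow> (\<exists>u\<in>verts G. \<exists>v\<in>verts G. f u = m \<and> f v = n \<and> u \<rightarrow>\<^bsub>G\<^esub> v)" for m n
  have inj: "u = v" if "f u = f v" "u \<in> verts G" "v \<in> verts G" for u v
    using f(1) that by (auto simp: bij_betw_def inj_on_def)
  have E: "E (f u) (f v) \<longleftrightarrow> u \<rightarrow>\<^bsub>G\<^esub> v" if "u \<in> verts G" "v \<in> verts G" for u v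
    unfolding E_def using inj that by metis
  have sym: "v \<rightarrow>\<^bsub>G\<^esub> u \<longleftrightarrow> u \<rightarrow>\<^bsub>G\<^esub> v" for u v
    using arcs_ends_symmetric[OF sym_arcs] by blast
  let ?a = "\<lambda>v. cube_corner E b (f v)"
  have less: "u \<rightarrow>\<^bsub>G\<^esub> v \<longleftrightarrow> (\<forall>i\<in>{1..b + 1}. \<bar>?a u i - ?a v i\<bar> \<le> 1)"
    if uv: "u \<in> verts G" "v \<in> verts G" "f u < f v" for u v
  proof -
    have "f v \<le> f u + b" if "u \<rightarrow>\<^bsub>G\<^esub> v"
      using arc_width_le[OF assms(1) that, of f] f(2) by linarith
    then show ?thesis
      using cube_corner_iff[of "f u" "f v" E b] uv E by blast
  qed
  have "u \<rightarrow>\<^bsub>G\<^esub> v \<longleftrightarrow> (\<forall>i\<in>{1..b + 1}. \<bar>?a u i - ?a v i\<bar> \<le> 1)"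
    if uv: "u \<in> verts G" "v \<in> verts G" "u \<noteq> v" for u v
  proof (cases "f u < f v")
    case True
    then show ?thesis using less uv by blast
  next
    case False
    then have "f v < f u" using inj uv by (meson linorder_neqE_nat)
    then show ?thesis using less[OF uv(2,1)] sym by (simp add: abs_minus_commute)
  qed
  then have "cube_representation G (b + 1) (\<lambda>v. \<Pi>\<^sub>E i\<in>{1..b + 1}. {?a v i..?a v i + 1})"
    unfolding cube_representation_def is_cube_def cubes_meet_iff by blast
  then show ?thesis
    unfolding cubicity_def by (intro Least_le) blast
qed

end
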